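(* Let $\lambda\in\mathbb{C}$ with $\lambda\neq 1$, let $r,k\in\mathbb{Z}$ and $n\ge 0$. Then \[ T_{n}^{(r,k)}(x|\lambda)=\sum_{m=0}^{n}\left\{ \sum_{l=0}^{n-m}(-1)^{l} \binom{n}{l+m} S_{2}(l+m,m)T_{n-m-l}^{(r,k)}(\lambda) \right\}x^{[m]}. \]
   Context: For $k\in\mathbb{Z}$, $Li_k(x)=\sum_{n\ge1}x^n/n^k$. For $r,k\in\mathbb{Z}$ the polynomials $T_n^{(r,k)}(x|\lambda)$ are defined by $\left(\frac{1-\lambda}{e^t-\lambda}\right)^r\frac{Li_{k}(1-e^{-t})}{1-e^{-t}}e^{xt}=\sum_{n\ge0}T_n^{(r,k)}(x|\lambda)\frac{t^n}{n!}$ (as formal power series in $t$), and $T_n^{(r,k)}(\lambda)=T_n^{(r,k)}(0|\lambda)$. $x^{[m]}=x(x+1)\cdots(x+m-1)$ is the rising factorial, and $S_2(l,m)$ denotes the Stirling numbers of the second kind, $(e^t-1)^m=m!\sum_{l\ge m}S_2(l,m)\frac{t^l}{l!}$. *)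

theory Defs
  imports Complex_Main
    "HOL-Computational_Algebra.Polynomial"
    "HOL-Computational_Algebra.Formal_Power_Series"
    "HOL-Combinatorics.Stirling"
begin

definition polylog_fps :: "int \<Rightarrow> complex fps" where
  "polylog_fps k = Abs_fps (\<lambda>n. if n = 0 then 0 else 1 / (of_nat n powi k))"

text \<open>The part of the generating function that does not involve \<open>x\<close>.  The first factor has a
  unit as denominator when \<open>lam \<noteq> 1\<close>; the second quotient is exact, see \<open>polylog_quotient_exact\<close>.\<close>

definition T_base_fps :: "int \<Rightarrow> int \<Rightarrow> complex \<Rightarrow> complex fps" where
  "T_base_fps r k lam =
     (fps_const (1 - lam) / (fps_exp 1 - fps_const lam)) powi r *
     (fps_compose (polylog_fps k) (1 - fps_exp (-1)) / (1 - fps_exp (-1)))"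

text \<open>Power series in \<open>t\<close> over the polynomials in \<open>x\<close>: the coefficientwise embedding of
  \<open>complex fps\<close>, and \<open>exp (x t)\<close>, whose \<open>n\<close>-th coefficient is \<open>x ^ n / n!\<close>.\<close>

definition lift_fps :: "complex fps \<Rightarrow> complex poly fps" where
  "lift_fps F = Abs_fps (\<lambda>n. [:fps_nth F n:])"

definition exp_xt_fps :: "complex poly fps" where
  "exp_xt_fps = Abs_fps (\<lambda>n. monom (1 / fact n) n)"

definition T_poly :: "int \<Rightarrow> int \<Rightarrow> complex \<Rightarrow> nat \<Rightarrow> complex poly" where
  "T_poly r k lam n = smult (fact n) (fps_nth (lift_fps (T_base_fps r k lam) * exp_xt_fps) n)"

definition T_num :: "int \<Rightarrow> int \<Rightarrow> complex \<Rightarrow> nat \<Rightarrow> complex" where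
  "T_num r k lam n = poly (T_poly r k lam n) 0"

lemma polylog_quotient_exact:
  "fps_compose (polylog_fps k) (1 - fps_exp (-1)) / (1 - fps_exp (-1)) * (1 - fps_exp (-1))
     = fps_compose (polylog_fps k) (1 - fps_exp (-1 :: complex))"
proof -
  let ?u = "1 - fps_exp (-1) :: complex fps"
  define G :: "complex fps" where "G = Abs_fps (\<lambda>n. 1 / (of_nat (Suc n) powi k))"
  have u0: "fps_nth ?u 0 = 0" by simp
  have "polylog_fps k = G * fps_X"
    by (rule fps_ext) (auto simp: polylog_fps_def G_def)
  then have "fps_compose (polylog_fps k) ?u = fps_compose G ?u * ?u"
    using u0 by (simp add: fps_compose_mult_distrib)
  then show ?thesis
    by (metis dvd_div_mult_self dvd_triv_right)
qed

text \<open>Evaluating at a number \<open>x\<close> gives back the generating function with \<open>exp (x t)\<close> taken in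
  \<open>complex fps\<close>.\<close>

lemma poly_T_poly:
  "poly (T_poly r k lam n) x = fact n * fps_nth (T_base_fps r k lam * fps_exp x) n"
  by (simp add: T_poly_def lift_fps_def exp_xt_fps_def fps_mult_nth poly_sum poly_monom)

text \<open>\<open>Stirling\<close> is defined in the library by its recurrence; this is its generating function.\<close>

lemma Stirling_generating_function:
  "(fps_exp 1 - 1) ^ m =
     (fps_const (fact m) * Abs_fps (\<lambda>l. of_nat (Stirling l m) / fact l) :: complex fps)"
proof -
  let ?E = "fps_exp 1 :: complex fps"
  have "fact l * fps_nth ((?E - 1) ^ m) l = fact m * of_nat (Stirling l m)" for l
  proof (induction l arbitrary: m)
    case 0
    then show ?case by (cases m) (simp_all add: fps_power_zeroth)
  next
    case (Suc l)
    show ?case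
    proof (cases m)
      case 0
      then show ?thesis by simp
    next
      case (Suc j)
      have "fps_deriv ((?E - 1) ^ Suc j) = of_nat (Suc j) * ((?E - 1) ^ Suc j + (?E - 1) ^ j)"
        unfolding fps_deriv_power' by (simp add: algebra_simps del: of_nat_Suc)
      then have "fps_nth (fps_deriv ((?E - 1) ^ Suc j)) l
          = of_nat (Suc j) * (fps_nth ((?E - 1) ^ Suc j) l + fps_nth ((?E - 1) ^ j) l)"
        by (simp only: fps_of_nat[symmetric] fps_mult_left_const_nth fps_add_nth)
      then have "of_nat (Suc l) * fps_nth ((?E - 1) ^ Suc j) (Suc l)
          = of_nat (Suc j) * (fps_nth ((?E - 1) ^ Suc j) l + fps_nth ((?E - 1) ^ j) l)"
        by (simp only: fps_deriv_nth Suc_eq_plus1)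
      then have "fact (Suc l) * fps_nth ((?E - 1) ^ Suc j) (Suc l)
          = of_nat (Suc j) * (fact l * fps_nth ((?E - 1) ^ Suc j) l
                              + fact l * fps_nth ((?E - 1) ^ j) l)"
        unfolding fact_Suc by (metis (no_types, lifting) distrib_left mult.commute mult.left_commute)
      also have "\<dots> = fact (Suc j) * of_nat (Stirling (Suc l) (Suc j))"
        unfolding Suc.IH by (simp add: algebra_simps)
      finally show ?thesis using Suc by simp
    qed
  qed
  then show ?thesis
    by (intro fps_ext) (simp add: field_simps)
qed

end

theory Submission
  imports Defs
begin

text \<open>The factor \<open>exp (x t)\<close> makes \<open>T_n(x)\<close> an Appell sequence,
  \<open>T_n(x) = (\<Sum>j\<le>n. binom(n,j) T_{n-j} x^j)\<close>. Expand each \<open>x^j\<close> in rising factorials, where the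
  coefficients are signed Stirling numbers of the second kind, and put \<open>j = l + m\<close>.\<close>

text \<open>Induction on \<open>j\<close>: writing \<open>x = (x + m) - m\<close>, the factor
  \<open>x + m\<close> raises the rising factorial by one degree, and the two resulting terms match
  the recurrence of \<open>Stirling\<close>.\<close>

lemma power_eq_sum_Stirling_pochhammer:
  fixes x :: "'a :: comm_ring_1"
  shows "x ^ j = (\<Sum>m\<le>j. (-1) ^ (j - m) * of_nat (Stirling j m) * pochhammer x m)"
proof (induction j)
  case 0
  show ?case by simp
next
  case (Suc j)
  define c where "c m = (-1) ^ (j - m) * of_nat (Stirling j m) * pochhammer x m" for m
  have "x ^ Suc j = (\<Sum>m\<le>j. c m * x)"
    by (simp add: Suc.IH c_def sum_distrib_left mult_ac)
  \<comment> \<open>The extra summand at \<open>Suc j\<close> is zero because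
    \<open>Stirling j (Suc j) = 0\<close>; after the index shift both sums run over
    \<open>m \<le> j\<close>.\<close>
  also have "\<dots> = (\<Sum>m\<le>j. c m * (x + of_nat m)) - (\<Sum>m\<le>Suc j. of_nat m * c m)"
    by (simp add: c_def algebra_simps flip: sum_subtractf)
  also have "(\<Sum>m\<le>Suc j. of_nat m * c m) = (\<Sum>m\<le>j. of_nat (Suc m) * c (Suc m))"
    by (subst sum.atMost_Suc_shift) simp
  also have "(\<Sum>m\<le>j. c m * (x + of_nat m)) - \<dots>
      = (\<Sum>m\<le>j. (-1) ^ (Suc j - Suc m) * of_nat (Stirling (Suc j) (Suc m)) * pochhammer x (Suc m))"
    unfolding sum_subtractf[symmetric]
  proof (rule sum.cong)
    fix m assume "m \<in> {..j}"
    \<comment> \<open>For \<open>m < j\<close> the exponents \<open>j - m\<close> and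
      \<open>j - Suc m\<close> differ by one, so the sign flips and the terms add. For
      \<open>m = j\<close> the truncated subtraction breaks this, but there
      \<open>c (Suc m) = 0\<close>.\<close>
    then consider "m = j" | d where "j = Suc (m + d)"
      by (metis atMost_iff le_neq_implies_less less_imp_Suc_add)
    then show "c m * (x + of_nat m) - of_nat (Suc m) * c (Suc m)
        = (-1) ^ (Suc j - Suc m) * of_nat (Stirling (Suc j) (Suc m)) * pochhammer x (Suc m)"
      by cases (simp_all add: c_def pochhammer_Suc algebra_simps)
  qed simp
  also have "\<dots> = (\<Sum>m\<le>Suc j. (-1) ^ (Suc j - m) * of_nat (Stirling (Suc j) m) * pochhammer x m)"
    by (subst sum.atMost_Suc_shift) simp
  finally show ?case .
qed

lemma poly_pochhammer: "poly (pochhammer p m) x = pochhammer (poly p x) m"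
  by (simp add: pochhammer_prod poly_prod)

lemma T_num_conv: "T_num r k lam n = fact n * fps_nth (T_base_fps r k lam) n"
  by (simp add: T_num_def poly_T_poly)

text \<open>Cauchy product with \<open>fps_exp x\<close>, where n!/j! = binom(n,j) (n-j)! and the
  factor (n-j)! is absorbed into \<open>T_num\<close>.\<close>

lemma poly_T_poly_conv_T_num:
  "poly (T_poly r k lam n) x = (\<Sum>j\<le>n. of_nat (n choose j) * T_num r k lam (n - j) * x ^ j)"
proof -
  have "poly (T_poly r k lam n) x
      = (\<Sum>j\<le>n. fact n * (x ^ j / fact j * fps_nth (T_base_fps r k lam) (n - j)))"
    by (simp add: poly_T_poly mult.commute[of "T_base_fps r k lam"] fps_mult_nth sum_distrib_left
        atLeast0AtMost)
  also have "\<dots> = (\<Sum>j\<le>n. of_nat (n choose j) * T_num r k lam (n - j) * x ^ j)"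
    by (rule sum.cong) (simp_all add: T_num_conv binomial_fact)
  finally show ?thesis .
qed

theorem theorem10:
  fixes lam :: complex and r k :: int and n :: nat
  assumes "lam \<noteq> 1"
  shows "T_poly r k lam n =
    (\<Sum>m=0..n. smult
       (\<Sum>l=0..n - m. (-1) ^ l * of_nat (n choose (l + m)) * of_nat (Stirling (l + m) m)
                       * T_num r k lam (n - m - l))
       (pochhammer [:0, 1:] m))"
proof (rule poly_eq_poly_eq_iff[THEN iffD1], rule ext)
  fix x
  define g where "g j m = of_nat (n choose j) * T_num r k lam (n - j)
      * ((-1) ^ (j - m) * of_nat (Stirling j m) * pochhammer x m)" for j m
  have "poly (T_poly r k lam n) x = (\<Sum>j\<le>n. \<Sum>m\<le>j. g j m)"
    by (simp add: poly_T_poly_conv_T_num power_eq_sum_Stirling_pochhammer[of x] g_def sum_distrib_left)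
  \<comment> \<open>The triangle \<open>m \<le> j \<le> n\<close> is summed by \<open>m\<close>
    first, with \<open>l = j - m\<close> as the new inner index.\<close>
  also have "\<dots> = (\<Sum>m\<le>n. \<Sum>l\<le>n - m. g (l + m) m)"
    unfolding sum.Sigma[OF finite_atMost ballI[OF finite_atMost]]
    by (rule sum.reindex_bij_witness[of _ "\<lambda>(m, l). (l + m, m)" "\<lambda>(j, m). (m, j - m)"]) auto
  also have "\<dots> = poly (\<Sum>m=0..n. smult
       (\<Sum>l=0..n - m. (-1) ^ l * of_nat (n choose (l + m)) * of_nat (Stirling (l + m) m)
                       * T_num r k lam (n - m - l))
       (pochhammer [:0, 1:] m)) x"
    by (simp add: poly_sum poly_pochhammer sum_distrib_left g_def atLeast0AtMost mult_ac add.commute)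
  finally show "poly (T_poly r k lam n) x = poly (\<Sum>m=0..n. smult
       (\<Sum>l=0..n - m. (-1) ^ l * of_nat (n choose (l + m)) * of_nat (Stirling (l + m) m)
                       * T_num r k lam (n - m - l))
       (pochhammer [:0, 1:] m)) x" .
qed

end
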